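(* $\mathrm{IP}\supset\mathrm{HE}$: for every formula $Px$, the formula $\exists y\,(\exists x\,Px\to Py)$ is derivable in minimal first-order logic extended by all instances of the scheme IP.
   Context: Minimal logic is first-order natural deduction with the introduction and elimination rules for $\to,\wedge,\vee,\forall,\exists$, in which $\bot$ is a propositional constant with no special rule. Schemata, for arbitrary formulas $Px$, $Q$ (possibly with further free variables), with $Py$ denoting $Px$ with the fresh variable $y$ substituted for $x$: $\mathrm{HE}(Px) := \exists y\,(\exists x\, Px \to Py)$ (schematic form of Hilbert's Epsilon) and $\mathrm{IP}(Px,Q):=(\exists x\,Q\to\exists x\,Px)\to\exists x\,(\exists x\,Q\to Px)$ (Independence of Premise). Extending by a scheme means adding, for every formula instance of it, a premise-free deduction rule concluding that instance. $S\supset T$ means that every instance of $T$ is derivable in minimal logic extended by $S$. *)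

theory Defs
  imports Main
begin

text \<open>
  Formulas are in de Bruijn form, so they are identified up to renaming of bound variables.
  A language is a pair of sets \<open>F\<close>, \<open>R\<close> of function and relation symbols with their arities;
  either may be empty, and nullary symbols are constants and propositional letters.
\<close>

datatype 'f tm = Var nat | Fun 'f "'f tm list"

datatype ('f, 'r) fm =
    Bot
  | Rel 'r "'f tm list"
  | Imp "('f, 'r) fm" "('f, 'r) fm"
  | Con "('f, 'r) fm" "('f, 'r) fm"
  | Dis "('f, 'r) fm" "('f, 'r) fm"
  | All "('f, 'r) fm"
  | Ex "('f, 'r) fm"

primrec wf_tm :: "('f \<times> nat) set \<Rightarrow> 'f tm \<Rightarrow> bool" where
  "wf_tm F (Var n) \<longleftrightarrow> True"
| "wf_tm F (Fun f ts) \<longleftrightarrow> (f, length ts) \<in> F \<and> list_all (wf_tm F) ts"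

primrec wf_fm :: "('f \<times> nat) set \<Rightarrow> ('r \<times> nat) set \<Rightarrow> ('f, 'r) fm \<Rightarrow> bool" where
  "wf_fm F R Bot \<longleftrightarrow> True"
| "wf_fm F R (Rel r ts) \<longleftrightarrow> (r, length ts) \<in> R \<and> list_all (wf_tm F) ts"
| "wf_fm F R (Imp A B) \<longleftrightarrow> wf_fm F R A \<and> wf_fm F R B"
| "wf_fm F R (Con A B) \<longleftrightarrow> wf_fm F R A \<and> wf_fm F R B"
| "wf_fm F R (Dis A B) \<longleftrightarrow> wf_fm F R A \<and> wf_fm F R B"
| "wf_fm F R (All A) \<longleftrightarrow> wf_fm F R A"
| "wf_fm F R (Ex A) \<longleftrightarrow> wf_fm F R A"

primrec subst_tm :: "(nat \<Rightarrow> 'f tm) \<Rightarrow> 'f tm \<Rightarrow> 'f tm" where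
  "subst_tm s (Var n) = s n"
| "subst_tm s (Fun f ts) = Fun f (map (subst_tm s) ts)"

text \<open>The substitution to be used below a quantifier.\<close>

definition under :: "(nat \<Rightarrow> 'f tm) \<Rightarrow> nat \<Rightarrow> 'f tm" where
  "under s = case_nat (Var 0) (\<lambda>n. subst_tm (\<lambda>k. Var (Suc k)) (s n))"

primrec subst_fm :: "(nat \<Rightarrow> 'f tm) \<Rightarrow> ('f, 'r) fm \<Rightarrow> ('f, 'r) fm" where
  "subst_fm s Bot = Bot"
| "subst_fm s (Rel r ts) = Rel r (map (subst_tm s) ts)"
| "subst_fm s (Imp A B) = Imp (subst_fm s A) (subst_fm s B)"
| "subst_fm s (Con A B) = Con (subst_fm s A) (subst_fm s B)"
| "subst_fm s (Dis A B) = Dis (subst_fm s A) (subst_fm s B)"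
| "subst_fm s (All A) = All (subst_fm (under s) A)"
| "subst_fm s (Ex A) = Ex (subst_fm (under s) A)"

text \<open>
  \<open>lift A\<close> is \<open>A\<close> read in the scope of one further variable, number 0, which is not free in it.
  \<open>inst t A\<close> substitutes \<open>t\<close> for variable 0 and removes that variable from the scope.
\<close>

definition lift :: "('f, 'r) fm \<Rightarrow> ('f, 'r) fm" where
  "lift A = subst_fm (\<lambda>n. Var (Suc n)) A"

definition inst :: "'f tm \<Rightarrow> ('f, 'r) fm \<Rightarrow> ('f, 'r) fm" where
  "inst t A = subst_fm (case_nat t Var) A"

text \<open>
  \<open>derivable F R S G A\<close>: in the language \<open>F\<close>, \<open>R\<close>, the formula \<open>A\<close> has a natural deduction from
  open assumptions among \<open>G\<close> in minimal logic extended by the formulas of \<open>S\<close> as premise-free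
  rules. The eigenvariable conditions of \<open>AllI\<close> and \<open>ExE\<close> are expressed by \<open>lift\<close>: they only
  concern open assumptions (and the conclusion), not \<open>S\<close>. There is no rule for \<open>Bot\<close>.
\<close>

inductive derivable ::
  "('f \<times> nat) set \<Rightarrow> ('r \<times> nat) set \<Rightarrow> ('f, 'r) fm set \<Rightarrow>
   ('f, 'r) fm set \<Rightarrow> ('f, 'r) fm \<Rightarrow> bool"
  for F :: "('f \<times> nat) set" and R :: "('r \<times> nat) set" and S :: "('f, 'r) fm set"
where
  Scheme: "A \<in> S \<Longrightarrow> wf_fm F R A \<Longrightarrow> derivable F R S G A"
| Assm: "A \<in> G \<Longrightarrow> wf_fm F R A \<Longrightarrow> derivable F R S G A"
| ImpI: "wf_fm F R A \<Longrightarrow> derivable F R S (insert A G) B \<Longrightarrow> derivable F R S G (Imp A B)"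
| ImpE: "derivable F R S G (Imp A B) \<Longrightarrow> derivable F R S G A \<Longrightarrow> derivable F R S G B"
| ConI: "derivable F R S G A \<Longrightarrow> derivable F R S G B \<Longrightarrow> derivable F R S G (Con A B)"
| ConE1: "derivable F R S G (Con A B) \<Longrightarrow> derivable F R S G A"
| ConE2: "derivable F R S G (Con A B) \<Longrightarrow> derivable F R S G B"
| DisI1: "derivable F R S G A \<Longrightarrow> wf_fm F R B \<Longrightarrow> derivable F R S G (Dis A B)"
| DisI2: "wf_fm F R A \<Longrightarrow> derivable F R S G B \<Longrightarrow> derivable F R S G (Dis A B)"
| DisE: "derivable F R S G (Dis A B) \<Longrightarrow> derivable F R S (insert A G) C \<Longrightarrow>
    derivable F R S (insert B G) C \<Longrightarrow> derivable F R S G C"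
| AllI: "derivable F R S (lift ` G) A \<Longrightarrow> derivable F R S G (All A)"
| AllE: "derivable F R S G (All A) \<Longrightarrow> wf_tm F t \<Longrightarrow> derivable F R S G (inst t A)"
| ExI: "wf_tm F t \<Longrightarrow> derivable F R S G (inst t A) \<Longrightarrow> derivable F R S G (Ex A)"
| ExE: "derivable F R S G (Ex A) \<Longrightarrow> derivable F R S (insert A (lift ` G)) (lift C) \<Longrightarrow>
    derivable F R S G C"

text \<open>
  In \<open>HE P\<close> and \<open>IP P Q\<close> the variable \<open>x\<close> of \<open>Px\<close> (and of \<open>Q\<close>, which may but need not contain
  \<open>x\<close>) is variable 0 and the larger indices are parameters. The second occurrence of \<open>P\<close> in
  \<open>HE P\<close> is bound by the outer quantifier, so it stands for \<open>Py\<close>.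
\<close>

definition HE :: "('f, 'r) fm \<Rightarrow> ('f, 'r) fm" where
  "HE P = Ex (Imp (lift (Ex P)) P)"

definition IP :: "('f, 'r) fm \<Rightarrow> ('f, 'r) fm \<Rightarrow> ('f, 'r) fm" where
  "IP P Q = Imp (Imp (Ex Q) (Ex P)) (Ex (Imp (lift (Ex Q)) P))"

definition HE_scheme :: "('f \<times> nat) set \<Rightarrow> ('r \<times> nat) set \<Rightarrow> ('f, 'r) fm set" where
  "HE_scheme F R = {HE P | P. wf_fm F R P}"

definition IP_scheme :: "('f \<times> nat) set \<Rightarrow> ('r \<times> nat) set \<Rightarrow> ('f, 'r) fm set" where
  "IP_scheme F R = {IP P Q | P Q. wf_fm F R P \<and> wf_fm F R Q}"

definition scheme_implies ::
  "('f \<times> nat) set \<Rightarrow> ('r \<times> nat) set \<Rightarrow> ('f, 'r) fm set \<Rightarrow> ('f, 'r) fm set \<Rightarrow> bool" where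
  "scheme_implies F R S T \<longleftrightarrow> (\<forall>A \<in> T. derivable F R S {} A)"

end

theory Submission
  imports Defs
begin

text \<open>
  Taking \<open>Q\<close> to be \<open>P\<close> in Independence of Premise makes its conclusion literally Hilbert's
  Epsilon for \<open>P\<close>, while its premise becomes \<open>\<exists>x Px \<longrightarrow> \<exists>x Px\<close>, which minimal logic proves.
  One modus ponens finishes. What remains is that this instance is a formula of the
  language; since it contains a lifted formula, this rests on substitution preserving
  well-formedness (\<open>wf_fm_subst\<close>).
\<close>

lemma wf_tm_subst:
  assumes "\<And>n. wf_tm F (s n)" and "wf_tm F t"
  shows "wf_tm F (subst_tm s t)"
  using assms(2) by (induction t) (auto simp: assms(1) list_all_iff)

lemma wf_tm_under:
  assumes "\<And>n. wf_tm F (s n)"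
  shows "wf_tm F (under s n)"
  by (cases n) (simp_all add: under_def wf_tm_subst assms)

lemma wf_fm_subst:
  assumes "\<And>n. wf_tm F (s n)" and "wf_fm F R A"
  shows "wf_fm F R (subst_fm s A)"
  using assms by (induction A arbitrary: s) (auto simp: list_all_iff wf_tm_subst wf_tm_under)

lemma wf_fm_lift: "wf_fm F R A \<Longrightarrow> wf_fm F R (lift A)"
  by (simp add: lift_def wf_fm_subst)

lemma IP_same_formula: "IP P P = Imp (Imp (Ex P) (Ex P)) (HE P)"
  by (simp add: IP_def HE_def)

theorem proposition13:
  fixes F :: "('f \<times> nat) set" and R :: "('r \<times> nat) set"
  shows "scheme_implies F R (IP_scheme F R) (HE_scheme F R)"
  unfolding scheme_implies_def
proof
  fix A :: "('f, 'r) fm"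
  assume "A \<in> HE_scheme F R"
  then obtain P where A: "A = HE P" and P: "wf_fm F R P"
    by (auto simp: HE_scheme_def)
  have "IP P P \<in> IP_scheme F R"
    using P by (auto simp: IP_scheme_def)
  moreover have "wf_fm F R (IP P P)"
    using P wf_fm_lift[of F R "Ex P"] by (simp add: IP_def)
  ultimately have "derivable F R (IP_scheme F R) {} (IP P P)"
    by (rule derivable.Scheme)
  moreover have "derivable F R (IP_scheme F R) {} (Imp (Ex P) (Ex P))"
    using P by (intro derivable.ImpI derivable.Assm) simp_all
  ultimately show "derivable F R (IP_scheme F R) {} A"
    unfolding A IP_same_formula by (rule derivable.ImpE)
qed

end
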